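(* Every real Banach space that is an almost-CL-space is a GL-space.
   Context: All spaces are over the real field. $B_E$, $S_E$, $E^*$ denote the closed unit ball, the unit sphere and the dual of $E$. A Banach space $E$ is an almost-CL-space if for every maximal convex subset $C$ of $S_E$ (maximal with respect to inclusion among convex subsets of $S_E$) one has $B_E=\overline{\mathrm{co}}(C\cup -C)$, where $\overline{\mathrm{co}}$ denotes the norm-closed convex hull. A Banach space $E$ is a GL-space (generalized-lush space) if for every $x\in S_E$ and every $\varepsilon>0$ there is $x^*\in S_{E^*}$ such that, with $S=S(x^*,\varepsilon)=\{z\in B_E: x^*(z)>1-\varepsilon\}$, one has $x\in S$ and $\mathrm{dist}(y,S)+\mathrm{dist}(y,-S)<2+\varepsilon$ for all $y\in S_E$. *)

theory Defs
  imports "HOL-Analysis.Analysis"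
begin

definition maximal_convex_subset :: "'a::real_vector set \<Rightarrow> 'a set \<Rightarrow> bool" where
  "maximal_convex_subset A C \<longleftrightarrow>
     convex C \<and> C \<subseteq> A \<and> (\<forall>D. convex D \<and> D \<subseteq> A \<and> C \<subseteq> D \<longrightarrow> D = C)"

definition almost_CL_space :: "'a::banach itself \<Rightarrow> bool" where
  "almost_CL_space _ \<longleftrightarrow>
     (\<forall>C :: 'a set. maximal_convex_subset (sphere 0 1) C \<longrightarrow>
        cball 0 1 = closure (convex hull (C \<union> uminus ` C)))"

text \<open>The dual space is the type of bounded linear functionals into the reals; its norm is the
  operator norm.\<close>

definition slice :: "('a::real_normed_vector \<Rightarrow>\<^sub>L real) \<Rightarrow> real \<Rightarrow> 'a set" where
  "slice f \<epsilon> = {z \<in> cball 0 1. blinfun_apply f z > 1 - \<epsilon>}"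

text \<open>The library's \<^term>\<open>infdist y A\<close> is zero by convention for empty \<open>A\<close>; below, the
  slice is nonempty because it contains \<open>x\<close>.\<close>

definition GL_space :: "'a::banach itself \<Rightarrow> bool" where
  "GL_space _ \<longleftrightarrow>
     (\<forall>x \<in> sphere (0::'a) 1. \<forall>\<epsilon>>0. \<exists>f \<in> sphere (0 :: 'a \<Rightarrow>\<^sub>L real) 1.
        x \<in> slice f \<epsilon> \<and>
        (\<forall>y \<in> sphere 0 1.
           infdist y (slice f \<epsilon>) + infdist y (uminus ` slice f \<epsilon>) < 2 + \<epsilon>))"

end

theory Submission
  imports Defs
begin

text \<open>
  Let \<open>C\<close> be a maximal convex subset of the sphere containing \<open>x\<close>. By convexity the norm is additive
  on the cone \<open>K\<close> generated by \<open>C\<close>, and in an almost-CL-space \<open>K - K\<close> is dense. On \<open>K - K\<close> the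
  sublinear function \<open>p x = (INF w\<in>K. norm (x + w) - norm w)\<close> is odd, since
  \<open>p (v - w) = norm v - norm w\<close>; being 1-Lipschitz it is odd everywhere, hence linear. This yields,
  without Hahn-Banach, a norm-one functional equal to 1 on \<open>C\<close>, so \<open>C\<close> lies in all its slices.
  If \<open>y\<close> is close to \<open>a c - b c'\<close> with \<open>a + b = 1\<close> and \<open>c, c'\<close> in \<open>C\<close>, then up to the same error
  \<open>y\<close> has distance at most \<open>2b\<close> from \<open>c\<close> and at most \<open>2a\<close> from \<open>-c'\<close>.
\<close>

text \<open>Zorn's lemma for the convex sets between \<open>A\<close> and \<open>S\<close>. The
  union of a chain is again convex because any two of its points already lie in a common
  member.\<close>

lemma ex_maximal_convex_subset_superset:
  assumes "convex A" "A \<subseteq> S"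
  obtains C where "maximal_convex_subset S C" "A \<subseteq> C"
proof -
  let ?\<A> = "{D. convex D \<and> D \<subseteq> S \<and> A \<subseteq> D}"
  have "\<exists>M\<in>?\<A>. \<forall>X\<in>?\<A>. M \<subseteq> X \<longrightarrow> X = M"
  proof (rule subset_Zorn_nonempty)
    show "?\<A> \<noteq> {}"
      using assms by blast
    fix \<C> assume ne: "\<C> \<noteq> {}" and ch: "subset.chain ?\<A> \<C>"
    have sub: "\<C> \<subseteq> ?\<A>"
      using ch by (simp add: subset.chain_def)
    have "convex (\<Union>\<C>)"
    proof (rule convexI)
      fix x y :: 'a and u v :: real
      assume "x \<in> \<Union>\<C>" "y \<in> \<Union>\<C>" and uv: "0 \<le> u" "0 \<le> v" "u + v = 1"
      then obtain X Y where XY: "X \<in> \<C>" "Y \<in> \<C>" "x \<in> X" "y \<in> Y"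
        by blast
      with ch have "X \<subseteq> Y \<or> Y \<subseteq> X"
        by (metis subset_chain_def)
      with XY obtain Z where Z: "Z \<in> \<C>" "x \<in> Z" "y \<in> Z"
        by blast
      then have "u *\<^sub>R x + v *\<^sub>R y \<in> Z"
        using sub uv by (blast intro: convexD)
      with Z show "u *\<^sub>R x + v *\<^sub>R y \<in> \<Union>\<C>"
        by blast
    qed
    moreover have "\<Union>\<C> \<subseteq> S" "A \<subseteq> \<Union>\<C>"
      using ne sub by blast+
    ultimately show "\<Union>\<C> \<in> ?\<A>"
      by blast
  qed
  then obtain M where M: "M \<in> ?\<A>" and max: "\<forall>X\<in>?\<A>. M \<subseteq> X \<longrightarrow> X = M"
    by (rule bexE)
  have "D = M" if "convex D" "D \<subseteq> S" "M \<subseteq> D" for D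
  proof -
    have "D \<in> ?\<A>"
      using that M by auto
    then show ?thesis
      using max \<open>M \<subseteq> D\<close> by blast
  qed
  with M have "maximal_convex_subset S M" "A \<subseteq> M"
    unfolding maximal_convex_subset_def by simp_all
  then show thesis
    by (rule that)
qed

text \<open>A sum \<open>s c + t d\<close> with \<open>s + t > 0\<close> is \<open>s + t\<close>
  times a convex combination of \<open>c\<close> and \<open>d\<close>. That combination stays in
  \<open>C\<close>, so it has norm 1.\<close>

lemma norm_add_cone_hull:
  fixes C :: "'a::real_normed_vector set"
  assumes "convex C" "C \<subseteq> sphere 0 1" "v \<in> cone hull C" "w \<in> cone hull C"
  shows "norm (v + w) = norm v + norm w"
proof -
  obtain s c where v: "v = s *\<^sub>R c" "s \<ge> 0" "c \<in> C"
    using assms(3) by (auto simp: cone_hull_expl)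
  obtain t d where w: "w = t *\<^sub>R d" "t \<ge> 0" "d \<in> C"
    using assms(4) by (auto simp: cone_hull_expl)
  have n: "norm e = 1" if "e \<in> C" for e
    using assms(2) that by auto
  show ?thesis
  proof (cases "s + t = 0")
    case True
    then have "s = 0" "t = 0"
      using v(2) w(2) by linarith+
    then show ?thesis
      by (simp add: v w)
  next
    case False
    then have pos: "s + t > 0"
      using v(2) w(2) by linarith
    let ?e = "(s / (s + t)) *\<^sub>R c + (t / (s + t)) *\<^sub>R d"
    have "?e \<in> C"
      using pos v w by (intro convexD[OF assms(1)]) (auto simp flip: add_divide_distrib)
    moreover have "v + w = (s + t) *\<^sub>R ?e"
      using pos by (simp add: v w scaleR_add_right)
    ultimately have "norm (v + w) = s + t"
      using pos n by simp
    then show ?thesis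
      using v w n by simp
  qed
qed

lemma ex_functional_eq_norm_on_cone:
  fixes K :: "'a::real_normed_vector set"
  assumes K: "convex K" "cone K" "K \<noteq> {}"
    and norm_add: "\<And>v w. \<lbrakk>v \<in> K; w \<in> K\<rbrakk> \<Longrightarrow> norm (v + w) = norm v + norm w"
    and dense: "closure {v - w |v w. v \<in> K \<and> w \<in> K} = UNIV"
  obtains f :: "'a \<Rightarrow>\<^sub>L real" where "norm f \<le> 1" "\<And>v. v \<in> K \<Longrightarrow> blinfun_apply f v = norm v"
proof -
  have add: "v + w \<in> K" if "v \<in> K" "w \<in> K" for v w
    using K that by (metis convex_cone)
  have scale: "t *\<^sub>R v \<in> K" if "v \<in> K" "t \<ge> 0" for v t
    using K(2) that by (rule mem_cone)
  have zero: "0 \<in> K"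
    using K cone_0 cone_contains_0 by blast
  \<comment> \<open>Additivity of the norm on \<open>K\<close> makes the expression decrease when an
    element of \<open>K\<close> is added to \<open>w\<close>, so the infimum is a limit along
    \<open>K\<close>. The bound \<open>lower\<close> keeps it finite.\<close>
  define p where "p x = (INF w\<in>K. norm (x + w) - norm w)" for x
  have lower: "- norm x \<le> norm (x + w) - norm w" for x w :: 'a
    using norm_triangle_ineq4[of "x + w" x] by simp
  have bdd: "bdd_below ((\<lambda>w. norm (x + w) - norm w) ` K)" for x
    using lower by (auto intro!: bdd_belowI2)
  have p_le: "p x \<le> norm (x + w) - norm w" if "w \<in> K" for x w
    unfolding p_def using bdd that by (rule cINF_lower)
  have p_ge: "m \<le> p x" if "\<And>w. w \<in> K \<Longrightarrow> m \<le> norm (x + w) - norm w" for m x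
    unfolding p_def using K(3) that by (rule cINF_greatest)
  have p_norm: "\<bar>p x\<bar> \<le> norm x" for x
    using p_le[OF zero, of x] p_ge[OF lower, of x] by simp
  have p_sub: "p (x + y) \<le> p x + p y" for x y
  proof -
    \<comment> \<open>Test the infimum for \<open>x + y\<close> at \<open>v + w\<close>, whose norm
      splits. Then take infima over \<open>w\<close> and over \<open>v\<close> separately.\<close>
    have "p (x + y) - (norm (x + v) - norm v) \<le> norm (y + w) - norm w"
      if "v \<in> K" "w \<in> K" for v w
      using p_le[OF add[OF that], of "x + y"] norm_add[OF that]
        norm_triangle_ineq[of "x + v" "y + w"]
      by (simp add: algebra_simps)
    then have "p (x + y) - (norm (x + v) - norm v) \<le> p y" if "v \<in> K" for v
      using that by (blast intro: p_ge)
    then have "p (x + y) - p y \<le> norm (x + v) - norm v" if "v \<in> K" for v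
      using that by (smt (verit))
    then have "p (x + y) - p y \<le> p x"
      by (rule p_ge)
    then show ?thesis by simp
  qed
  have p_diff: "p (v - w) = norm v - norm w" if "v \<in> K" "w \<in> K" for v w
  proof (rule antisym)
    show "p (v - w) \<le> norm v - norm w"
      using p_le[OF that(2), of "v - w"] by simp
    show "norm v - norm w \<le> p (v - w)"
    proof (rule p_ge)
      fix u assume "u \<in> K"
      \<comment> \<open>The left side is \<open>norm (v + u)\<close>, and
        \<open>v + u = (v - w + u) + w\<close>.\<close>
      then have "norm v + norm u \<le> norm (v - w + u) + norm w"
        using norm_add[of v u] that norm_triangle_ineq[of "v - w + u" w] by simp
      then show "norm v - norm w \<le> norm (v - w + u) - norm u"
        by simp
    qed
  qed
  have "dist (p x) (p y) \<le> dist x y" for x y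
    using p_sub[of "x - y" y] p_sub[of "y - x" x] p_norm[of "x - y"] p_norm[of "y - x"]
    by (auto simp: dist_norm norm_minus_commute)
  then have cont: "continuous_on UNIV p"
    by (auto simp: continuous_on_iff intro: le_less_trans)
  \<comment> \<open>For \<open>x = v - w\<close> the values \<open>norm v - norm w\<close> and
    \<open>norm w - norm v\<close> cancel; continuity carries this to the closure. Oddness then
    turns subadditivity at \<open>- x\<close>, \<open>- y\<close> into superadditivity.\<close>
  have p_minus: "p (- x) = - p x" for x
  proof -
    let ?D = "{v - w |v w. v \<in> K \<and> w \<in> K}"
    have "continuous_on (closure ?D) (\<lambda>x. p (- x) + p x)"
      using cont by (intro continuous_intros continuous_on_subset[OF cont]
          continuous_on_compose2[OF cont]) auto
    moreover have "p (- x) + p x = 0" if "x \<in> ?D" for x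
      using that p_diff by force
    ultimately have "p (- x) + p x = 0"
      by (rule continuous_constant_on_closure) (use dense in auto)
    then show ?thesis by simp
  qed
  have p_add: "p (x + y) = p x + p y" for x y
    using p_sub[of x y] p_sub[of "- x" "- y"] p_minus[of x] p_minus[of y] p_minus[of "x + y"]
    by simp
  \<comment> \<open>Since \<open>K\<close> is a cone, \<open>t w\<close> is an admissible test point
    whenever \<open>w\<close> is.\<close>
  have scale_le: "p (t *\<^sub>R x) \<le> t * p x" if "t > 0" for t x
  proof -
    have "p (t *\<^sub>R x) / t \<le> norm (x + w) - norm w" if "w \<in> K" for w
    proof -
      have "p (t *\<^sub>R x) \<le> norm (t *\<^sub>R (x + w)) - norm (t *\<^sub>R w)"
        using p_le[OF scale[OF that], of t "t *\<^sub>R x"] \<open>t > 0\<close>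
        by (simp flip: scaleR_add_right)
      also have "\<dots> = t * (norm (x + w) - norm w)"
        using \<open>t > 0\<close> by (simp add: right_diff_distrib)
      finally show ?thesis
        using \<open>t > 0\<close> by (simp add: divide_le_eq mult.commute)
    qed
    then have "p (t *\<^sub>R x) / t \<le> p x"
      by (rule p_ge)
    then show ?thesis
      using that by (simp add: field_simps)
  qed
  \<comment> \<open>The same inequality at \<open>- x\<close> is the reverse one, by
    oddness.\<close>
  have scale_pos: "p (t *\<^sub>R x) = t * p x" if "t > 0" for t x
    using scale_le[OF that, of x] scale_le[OF that, of "- x"] by (simp add: p_minus)
  have p_scale: "p (t *\<^sub>R x) = t * p x" for t x
  proof (cases t "0::real" rule: linorder_cases)
    case less
    then show ?thesis
      using scale_pos[of "- t" x] by (simp add: p_minus)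
  next
    case equal
    then show ?thesis
      using p_norm[of 0] by simp
  qed (rule scale_pos)
  have lin: "bounded_linear p"
    by (rule bounded_linear_intro[where K = 1]) (use p_add p_scale p_norm in auto)
  show thesis
  proof
    show "norm (Blinfun p) \<le> 1"
      by (rule norm_blinfun_bound) (use p_norm in \<open>auto simp: bounded_linear_Blinfun_apply[OF lin]\<close>)
    show "blinfun_apply (Blinfun p) v = norm v" if "v \<in> K" for v
      using p_diff[OF that zero] by (simp add: bounded_linear_Blinfun_apply[OF lin])
  qed
qed

text \<open>Both \<open>C\<close> and its negative are convex, so a point of the hull needs only one
  point from each.\<close>

lemma convex_hull_Un_uminus_subset:
  fixes C :: "'a::real_normed_vector set"
  assumes "convex C"
  shows "convex hull (C \<union> uminus ` C) \<subseteq>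
    {a *\<^sub>R c - b *\<^sub>R d |a b c d. a \<ge> 0 \<and> b \<ge> 0 \<and> a + b = 1 \<and> c \<in> C \<and> d \<in> C}"
proof (cases "C = {}")
  case False
  \<comment> \<open>Indexing the two sets by \<open>bool\<close> presents them as a finite family of
    convex sets.\<close>
  let ?S = "\<lambda>i. if i then C else uminus ` C"
  show ?thesis
  proof
    fix z assume "z \<in> convex hull (C \<union> uminus ` C)"
    also have "C \<union> uminus ` C = \<Union> (range ?S)"
      by (auto simp: UNIV_bool)
    also have "convex hull \<Union> (range ?S) = {\<Sum>i\<in>UNIV. u i *\<^sub>R s i |u s.
        (\<forall>i\<in>UNIV. u i \<ge> 0) \<and> sum u UNIV = 1 \<and> (\<forall>i\<in>UNIV. s i \<in> ?S i)}"
      using False assms by (intro convex_hull_finite_union) (auto simp: convex_negations)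
    finally obtain u s where z: "z = (\<Sum>i\<in>UNIV. u i *\<^sub>R s i)"
      and u: "u True \<ge> 0" "u False \<ge> 0" "sum u UNIV = 1" and s: "\<And>i. s i \<in> ?S i"
      by blast
    have "s True \<in> C" "s False \<in> uminus ` C"
      using s[of True] s[of False] by simp_all
    then obtain d where "s True \<in> C" "d \<in> C" "s False = - d"
      by blast
    with z u show "z \<in> {a *\<^sub>R c - b *\<^sub>R d |a b c d. a \<ge> 0 \<and> b \<ge> 0 \<and> a + b = 1 \<and> c \<in> C \<and> d \<in> C}"
      by (intro CollectI exI[of _ "u True"] exI[of _ "u False"] exI[of _ "s True"] exI[of _ d])
        (simp add: UNIV_bool add.commute)
  qed
qed auto

text \<open>The approximant \<open>z\<close> lies on the segment from \<open>c\<close> to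
  \<open>- d\<close>, so its distances to the two endpoints add up to \<open>norm (c + d)\<close>,
  which is at most 2.\<close>

lemma infdist_slice_less:
  fixes C :: "'a::real_normed_vector set"
  assumes C: "C \<subseteq> cball 0 1" "C \<subseteq> S" and "convex C" and "e > 0"
    and y: "y \<in> closure (convex hull (C \<union> uminus ` C))"
  shows "infdist y S + infdist y (uminus ` S) < 2 + e"
proof -
  \<comment> \<open>The error \<open>dist z y\<close> enters once for \<open>S\<close> and once for
    its negative, hence \<open>e / 2\<close>.\<close>
  obtain z where z: "z \<in> convex hull (C \<union> uminus ` C)" "dist z y < e / 2"
    using y \<open>e > 0\<close> by (meson closure_approachable half_gt_zero)
  then obtain a b c d where z_eq: "z = a *\<^sub>R c - b *\<^sub>R d" and ab: "a \<ge> 0" "b \<ge> 0" "a + b = 1"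
    and cd: "c \<in> C" "d \<in> C"
    using convex_hull_Un_uminus_subset[OF \<open>convex C\<close>] by blast
  have "norm (c + d) \<le> 2"
    using subsetD[OF C(1) cd(1)] subsetD[OF C(1) cd(2)] norm_triangle_ineq[of c d] by simp
  have a: "a = 1 - b"
    using ab by simp
  have "c - z = b *\<^sub>R (c + d)" "z + d = a *\<^sub>R (c + d)"
    by (simp_all add: z_eq a algebra_simps)
  then have "dist z c = b * norm (c + d)" "dist z (- d) = a * norm (c + d)"
    using ab by (simp_all add: dist_norm norm_minus_commute[of z c])
  then have "dist z c + dist z (- d) = norm (c + d)"
    using ab by (simp flip: distrib_right add: add.commute)
  moreover have "infdist y S \<le> dist z c + dist z y"
    using C(2) cd dist_triangle3[of y c z] by (intro infdist_le2[of c]) auto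
  moreover have "infdist y (uminus ` S) \<le> dist z (- d) + dist z y"
    using C(2) cd dist_triangle3[of y "- d" z] by (intro infdist_le2[of "- d"]) auto
  ultimately show ?thesis
    using z(2) \<open>norm (c + d) \<le> 2\<close> by linarith
qed

theorem mainTheorem5:
  assumes "almost_CL_space TYPE('a::banach)"
  shows "GL_space TYPE('a)"
  unfolding GL_space_def
proof (intro ballI allI impI)
  fix x :: 'a and \<epsilon> :: real
  assume x: "x \<in> sphere 0 1" and \<epsilon>: "\<epsilon> > 0"
  obtain C where C: "maximal_convex_subset (sphere 0 1) C" "{x} \<subseteq> C"
    using x by (rule_tac ex_maximal_convex_subset_superset[of "{x}" "sphere 0 1"]) auto
  have ball: "cball 0 1 = closure (convex hull (C \<union> uminus ` C))"
    using assms C(1) by (simp add: almost_CL_space_def)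
  have conv: "convex C" and sph: "C \<subseteq> sphere 0 1"
    using C(1) by (auto simp: maximal_convex_subset_def)
  let ?K = "cone hull C"
  let ?D = "{v - w |v w. v \<in> ?K \<and> w \<in> ?K}"
  have CK: "C \<subseteq> ?K"
    by (rule hull_subset)
  have "convex hull (C \<union> uminus ` C) \<subseteq> ?D"
    using convex_hull_Un_uminus_subset[OF conv] by (fastforce simp: cone_hull_expl)
  then have unit: "cball 0 1 \<subseteq> closure ?D"
    unfolding ball by (rule closure_mono)
  \<comment> \<open>A cone that contains the unit ball is the whole space, by rescaling
    \<open>sgn y\<close>; so the closure of \<open>?D\<close> is everything.\<close>
  have "cone ?D"
    by (force simp: cone_def scaleR_diff_right intro: mem_cone[OF cone_cone_hull])
  then have "cone (closure ?D)"
    by (rule cone_closure)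
  have dense: "closure ?D = UNIV"
  proof (intro UNIV_eq_I[symmetric])
    fix y :: 'a
    have "sgn y \<in> closure ?D"
      using unit by (auto simp: subset_iff norm_sgn)
    then have "norm y *\<^sub>R sgn y \<in> closure ?D"
      by (intro mem_cone[OF \<open>cone (closure ?D)\<close>]) auto
    moreover have "norm y *\<^sub>R sgn y = y"
      by (cases "y = 0") (simp_all add: sgn_div_norm)
    ultimately show "y \<in> closure ?D"
      by simp
  qed
  obtain f :: "'a \<Rightarrow>\<^sub>L real" where f: "norm f \<le> 1" "\<And>v. v \<in> ?K \<Longrightarrow> blinfun_apply f v = norm v"
    using ex_functional_eq_norm_on_cone[OF convex_cone_hull[OF conv] cone_cone_hull _
        norm_add_cone_hull[OF conv sph] dense] C(2) CK by blast
  have f1: "blinfun_apply f c = 1" if "c \<in> C" for c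
    using f(2)[OF subsetD[OF CK that]] subsetD[OF sph that] by simp
  \<comment> \<open>The unit vector \<open>x\<close> lies in \<open>C\<close>, so \<open>f\<close>
    takes the value 1 there.\<close>
  have "1 \<le> norm f"
    using norm_blinfun[of f x] f1[of x] C(2) x by simp
  then have nf: "f \<in> sphere 0 1"
    using f(1) by simp
  have slice: "C \<subseteq> slice f \<epsilon>"
    using f1 sph \<epsilon> by (auto simp: slice_def)
  moreover have "infdist y (slice f \<epsilon>) + infdist y (uminus ` slice f \<epsilon>) < 2 + \<epsilon>"
    if "y \<in> sphere 0 1" for y
  proof (rule infdist_slice_less[OF _ slice conv \<epsilon>])
    show "C \<subseteq> cball 0 1"
      using sph by auto
    show "y \<in> closure (convex hull (C \<union> uminus ` C))"
      using that by (simp flip: ball)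
  qed
  ultimately show "\<exists>f\<in>sphere (0 :: 'a \<Rightarrow>\<^sub>L real) 1. x \<in> slice f \<epsilon> \<and>
      (\<forall>y\<in>sphere 0 1. infdist y (slice f \<epsilon>) + infdist y (uminus ` slice f \<epsilon>) < 2 + \<epsilon>)"
    using nf C(2) by blast
qed

end
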